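(* Every finite group $G$ admits a finite, just finite presentation. That is, for every finite group $G$ there exist a finite set $X$ and a finite set $R$ of relations over $X$ such that $\langle X \mid R \rangle$ is a presentation of $G$ and, for every $r \in R$, the group $\langle X \mid R \setminus \{r\} \rangle$ is infinite.
   Context: A presentation $\langle X \mid R \rangle$ of a finite group $G$ is called just finite if, for every $r \in R$, the group $\langle X \mid R \setminus \{r\} \rangle$ is infinite. A presentation is finite if both $X$ and $R$ are finite. *)

theory Defs
  imports "HOL-Algebra.Coset"
begin

text \<open>
  A letter is a pair of a generator and a sign: \<open>(x, True)\<close> stands for the generator \<open>x\<close> and
  \<open>(x, False)\<close> for its formal inverse.  The free group on \<open>X\<close> is realised on the freely reduced
  words over \<open>X\<close>.
\<close>

type_synonym 'a word = "('a \<times> bool) list"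

definition inv_letter :: "'a \<times> bool \<Rightarrow> 'a \<times> bool" where
  "inv_letter a = (fst a, \<not> snd a)"

definition reduced :: "'a word \<Rightarrow> bool" where
  "reduced w \<longleftrightarrow> successively (\<lambda>a b. b \<noteq> inv_letter a) w"

fun push :: "'a \<times> bool \<Rightarrow> 'a word \<Rightarrow> 'a word" where
  "push a [] = [a]"
| "push a (b # w) = (if b = inv_letter a then w else a # b # w)"

text \<open>
  For reduced \<open>v\<close>, \<open>foldr push u v\<close> is the free reduction of the concatenation \<open>u @ v\<close>.
\<close>

definition free_group :: "'a set \<Rightarrow> 'a word monoid" where
  "free_group X =
     \<lparr>carrier = {w. reduced w \<and> set w \<subseteq> X \<times> UNIV},
      mult = (\<lambda>u v. foldr push u v),
      one = []\<rparr>"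

definition free_gen :: "'a \<Rightarrow> 'a word" where
  "free_gen x = [(x, True)]"

definition normal_closure :: "('a, 'b) monoid_scheme \<Rightarrow> 'a set \<Rightarrow> 'a set" where
  "normal_closure G R = \<Inter> {N. N \<lhd> G \<and> R \<subseteq> N}"

definition presented_group :: "'a set \<Rightarrow> 'a word set \<Rightarrow> 'a word set monoid" where
  "presented_group X R = free_group X Mod normal_closure (free_group X) R"

definition is_presentation :: "'a set \<Rightarrow> 'a word set \<Rightarrow> ('g, 'm) monoid_scheme \<Rightarrow> bool" where
  "is_presentation X R G \<longleftrightarrow> R \<subseteq> carrier (free_group X) \<and> presented_group X R \<cong> G"

definition finite_presentation :: "'a set \<Rightarrow> 'a word set \<Rightarrow> ('g, 'm) monoid_scheme \<Rightarrow> bool" where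
  "finite_presentation X R G \<longleftrightarrow> is_presentation X R G \<and> finite X \<and> finite R"

definition just_finite_presentation :: "'a set \<Rightarrow> 'a word set \<Rightarrow> ('g, 'm) monoid_scheme \<Rightarrow> bool" where
  "just_finite_presentation X R G \<longleftrightarrow>
     is_presentation X R G \<and> finite (carrier G) \<and>
     (\<forall>r\<in>R. infinite (carrier (presented_group X (R - {r}))))"

lemma inv_letter_inv_letter [simp]: "inv_letter (inv_letter a) = a"
  by (simp add: inv_letter_def)

lemma fst_inv_letter [simp]: "fst (inv_letter a) = fst a"
  by (simp add: inv_letter_def)

lemma reduced_Nil [simp]: "reduced []"
  by (simp add: reduced_def)

lemma reduced_Cons: "reduced (a # w) \<longleftrightarrow> (w = [] \<or> hd w \<noteq> inv_letter a) \<and> reduced w"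
  by (auto simp: reduced_def successively_Cons)

lemma reduced_push: "reduced w \<Longrightarrow> reduced (push a w)"
  by (cases w) (auto simp: reduced_Cons)

lemma set_push: "set (push a w) \<subseteq> insert a (set w)"
  by (cases w) auto

lemma push_push_inv: "reduced w \<Longrightarrow> push a (push (inv_letter a) w) = w"
  by (cases w; cases "tl w") (auto simp: reduced_Cons)

lemma push_eq_Cons: "reduced (a # w) \<Longrightarrow> push a w = a # w"
  by (cases w) (auto simp: reduced_Cons)

lemma reduced_foldr_push: "reduced w \<Longrightarrow> reduced (foldr push u w)"
  by (induction u) (auto simp: reduced_push)

lemma set_foldr_push: "set (foldr push u w) \<subseteq> set u \<union> set w"
proof (induction u)
  case (Cons a u)
  then show ?case using set_push[of a "foldr push u w"] by auto
qed simp

lemma foldr_push_Nil: "reduced w \<Longrightarrow> foldr push w [] = w"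
  by (induction w) (auto simp: reduced_Cons push_eq_Cons)

lemma foldr_push_push:
  "reduced w \<Longrightarrow> foldr push (push a v) w = push a (foldr push v w)"
proof (cases v)
  case (Cons b v')
  assume "reduced w"
  then have "reduced (foldr push v' w)" by (rule reduced_foldr_push)
  then show ?thesis using Cons push_push_inv[of "foldr push v' w" a] by simp
qed simp

lemma foldr_push_assoc:
  "reduced w \<Longrightarrow> foldr push (foldr push u v) w = foldr push u (foldr push v w)"
  by (induction u) (simp_all add: foldr_push_push)

lemma foldr_push_inverse:
  "reduced w \<Longrightarrow> foldr push (rev (map inv_letter u)) (foldr push u w) = w"
proof (induction u arbitrary: w)
  case (Cons a u)
  have "reduced (foldr push u w)" using Cons.prems by (rule reduced_foldr_push)
  then have "push (inv_letter a) (push a (foldr push u w)) = foldr push u w"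
    using push_push_inv[of _ "inv_letter a"] by simp
  then show ?case using Cons by simp
qed simp

theorem group_free_group: "group (free_group X)"
proof (rule groupI)
  fix u v w assume uvw: "u \<in> carrier (free_group X)" "v \<in> carrier (free_group X)"
    "w \<in> carrier (free_group X)"
  show "u \<otimes>\<^bsub>free_group X\<^esub> v \<in> carrier (free_group X)"
    using uvw set_foldr_push[of u v] by (auto simp: free_group_def reduced_foldr_push)
  show "u \<otimes>\<^bsub>free_group X\<^esub> v \<otimes>\<^bsub>free_group X\<^esub> w = u \<otimes>\<^bsub>free_group X\<^esub> (v \<otimes>\<^bsub>free_group X\<^esub> w)"
    using uvw by (simp add: free_group_def foldr_push_assoc)
next
  fix u assume u: "u \<in> carrier (free_group X)"
  define v where "v = foldr push (rev (map inv_letter u)) []"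
  have "set v \<subseteq> set (map inv_letter u)"
    unfolding v_def using set_foldr_push[of "rev (map inv_letter u)" "[]"] by simp
  then have "v \<in> carrier (free_group X)"
    using u by (fastforce simp: free_group_def v_def reduced_foldr_push inv_letter_def)
  moreover have "v \<otimes>\<^bsub>free_group X\<^esub> u = \<one>\<^bsub>free_group X\<^esub>"
    using u foldr_push_inverse[of "[]" u] foldr_push_assoc[of u "rev (map inv_letter u)" "[]"]
    by (simp add: free_group_def v_def foldr_push_Nil)
  ultimately show "\<exists>v\<in>carrier (free_group X). v \<otimes>\<^bsub>free_group X\<^esub> u = \<one>\<^bsub>free_group X\<^esub>"
    by blast
qed (auto simp: free_group_def)

lemma free_gen_closed: "x \<in> X \<Longrightarrow> free_gen x \<in> carrier (free_group X)"
  by (simp add: free_gen_def free_group_def reduced_def)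

definition eval_word :: "('g, 'm) monoid_scheme \<Rightarrow> ('a \<Rightarrow> 'g) \<Rightarrow> 'a word \<Rightarrow> 'g" where
  "eval_word G f w =
     foldr (\<lambda>a g. (if snd a then f (fst a) else inv\<^bsub>G\<^esub> (f (fst a))) \<otimes>\<^bsub>G\<^esub> g) w \<one>\<^bsub>G\<^esub>"

lemma (in group) eval_word_closed:
  assumes "f \<in> X \<rightarrow> carrier G" "set w \<subseteq> X \<times> UNIV"
  shows "eval_word G f w \<in> carrier G"
  using assms by (induction w) (auto simp: eval_word_def Pi_iff)

lemma (in group) eval_word_push:
  assumes "f \<in> X \<rightarrow> carrier G" "set w \<subseteq> X \<times> UNIV" "fst a \<in> X"
  shows "eval_word G f (push a w) =
    (if snd a then f (fst a) else inv (f (fst a))) \<otimes> eval_word G f w"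
proof (cases w)
  case (Cons b w')
  have c: "eval_word G f w' \<in> carrier G" "f (fst a) \<in> carrier G"
    using assms Cons eval_word_closed[of f X w'] by auto
  then show ?thesis
    using Cons by (auto simp: eval_word_def inv_letter_def m_assoc[symmetric])
qed (simp add: eval_word_def)

theorem (in group) eval_word_hom:
  assumes f: "f \<in> X \<rightarrow> carrier G"
  shows "eval_word G f \<in> hom (free_group X) G"
proof (rule homI)
  fix u v assume "u \<in> carrier (free_group X)" and v: "v \<in> carrier (free_group X)"
  then have u: "set u \<subseteq> X \<times> UNIV" by (simp add: free_group_def)
  have v: "set v \<subseteq> X \<times> UNIV" using v by (simp add: free_group_def)
  have "eval_word G f (foldr push u v) = eval_word G f u \<otimes> eval_word G f v" using u
  proof (induction u)
    case Nil
    then show ?case using eval_word_closed[OF f v] by (simp add: eval_word_def)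
  next
    case (Cons a u)
    have s: "set (foldr push u v) \<subseteq> X \<times> UNIV" "set u \<subseteq> X \<times> UNIV" "fst a \<in> X"
      using set_foldr_push[of u v] v Cons.prems by auto
    have "f (fst a) \<in> carrier G" using f s by auto
    moreover note eval_word_closed[OF f v] eval_word_closed[OF f s(2)]
    ultimately show ?case
      using Cons.IH[OF s(2)] eval_word_push[OF f s(1) s(3)]
      by (simp add: eval_word_def m_assoc)
  qed
  then show "eval_word G f (u \<otimes>\<^bsub>free_group X\<^esub> v) = eval_word G f u \<otimes> eval_word G f v"
    by (simp add: free_group_def)
qed (use f eval_word_closed in \<open>auto simp: free_group_def\<close>)

lemma (in group) eval_word_free_gen:
  "f x \<in> carrier G \<Longrightarrow> eval_word G f (free_gen x) = f x"
  by (simp add: eval_word_def free_gen_def)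

theorem normal_normal_closure:
  assumes "group G" "R \<subseteq> carrier G"
  shows "normal_closure G R \<lhd> G"
proof -
  interpret group G by fact
  let ?S = "{N. N \<lhd> G \<and> R \<subseteq> N}"
  have ne: "?S \<noteq> {}"
    using assms normal_inv_iff subgroup_self by blast
  have "subgroup (\<Inter> ?S) G"
    using ne by (intro subgroups_Inter) (auto dest: normal_imp_subgroup)
  then show ?thesis
    unfolding normal_closure_def normal_inv_iff by (auto simp: normal_inv_iff)
qed

theorem group_presented_group:
  "R \<subseteq> carrier (free_group X) \<Longrightarrow> group (presented_group X R)"
  unfolding presented_group_def
  by (intro normal.factorgroup_is_group normal_normal_closure group_free_group)

end

theory Submission
  imports Defs Complex_Main "HOL-Algebra.Elementary_Groups" "HOL-Algebra.Multiplicative_Group"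
begin

text \<open>
  Start from a finite presentation \<open>\<langle>X | R\<rangle>\<close> of \<open>G\<close> in which no relator follows from the others
  (the multiplication table gives a finite presentation, and one with the fewest relators over the
  same generators is irredundant).  Removing a relator \<open>r\<close> then gives a group \<open>F\<close> in which \<open>r\<close> is
  nontrivial, but \<open>F\<close> may well be finite.  The idea is to add to the presentation some generators
  that die when \<open>r\<close> is trivial and that make the group infinite when it is not.  For every
  \<open>r \<in> R\<close> these are two new generators \<open>b\<close> and \<open>c\<close>, with the relations
  \<open>r\<inverse> b r = b^2\<close> and \<open>r\<inverse> c r = c^2\<close>.

  With all relators present, \<open>r = 1\<close> forces \<open>b = b^2\<close> and \<open>c = c^2\<close>, so \<open>b = c = 1\<close> and the group is
  still \<open>G\<close> (\<open>presented_group_padded\<close>).  Without the relator of \<open>b\<close> the group maps onto the integers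
  by \<open>b \<mapsto> 1\<close> and by killing all other generators, since \<open>b\<close> does not occur in the relators
  that remain (\<open>infinite_remove_squaring_relator\<close>).  The remaining case is the removal of some
  \<open>r \<in> R\<close> when \<open>F\<close> is finite (\<open>infinite_remove_original_relator\<close>).  Then \<open>r\<close> has a finite
  order \<open>m \<ge> 2\<close> in \<open>F\<close>, and the relations only force \<open>b\<close> and \<open>c\<close> to have orders dividing
  \<open>2^m - 1 \<ge> 3\<close>.  The lemma \<open>squared_pair\<close> realises them, in an action of \<open>F\<close> on copies of the
  complex plane, by rotations about different centres whose product is a translation.
\<close>


section \<open>Homomorphisms out of a presented group\<close>

lemma carrier_free_group_iff:
  "w \<in> carrier (free_group X) \<longleftrightarrow> reduced w \<and> set w \<subseteq> X \<times> UNIV"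
  by (simp add: free_group_def)

lemma eval_word_cong:
  assumes "set w \<subseteq> X \<times> UNIV" "\<And>x. x \<in> X \<Longrightarrow> f x = g x"
  shows "eval_word H f w = eval_word H g w"
  using assms by (induction w) (auto simp: eval_word_def)

lemma inv_free_gen:
  assumes "x \<in> X"
  shows "inv\<^bsub>free_group X\<^esub> (free_gen x) = [(x, False)]"
proof -
  interpret group "free_group X" by (rule group_free_group)
  show ?thesis
    using assms
    by (intro inv_equality free_gen_closed)
      (auto simp: free_group_def free_gen_def inv_letter_def reduced_def)
qed

lemma hom_free_group_eq_eval_word:
  assumes "group H" and h: "h \<in> hom (free_group X) H" and "w \<in> carrier (free_group X)"
  shows "h w = eval_word H (\<lambda>x. h (free_gen x)) w"
proof -
  interpret group_hom "free_group X" H h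
    using assms by (simp add: group_hom_def group_hom_axioms_def group_free_group)
  show ?thesis
    using assms(3)
  proof (induction w)
    case Nil
    show ?case
      using hom_one by (simp add: eval_word_def free_group_def)
  next
    case (Cons a w)
    obtain x e where a: "a = (x, e)" by (cases a)
    have x: "x \<in> X" and w: "w \<in> carrier (free_group X)"
      using Cons.prems a by (auto simp: carrier_free_group_iff reduced_Cons)
    have letter: "h [a] = (if e then h (free_gen x) else inv\<^bsub>H\<^esub> (h (free_gen x)))"
    proof (cases e)
      case False
      then show ?thesis
        using a x free_gen_closed[OF x] by (simp flip: inv_free_gen)
    qed (simp add: a free_gen_def)
    have "[a] \<in> carrier (free_group X)"
      using x a by (simp add: carrier_free_group_iff reduced_def)
    moreover have "a # w = [a] \<otimes>\<^bsub>free_group X\<^esub> w"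
      using Cons.prems by (simp add: free_group_def push_eq_Cons)
    ultimately have "h (a # w) = h [a] \<otimes>\<^bsub>H\<^esub> h w"
      using w by simp
    then show ?case
      using letter Cons.IH[OF w] by (simp add: eval_word_def a)
  qed
qed

lemma hom_free_group_eqI:
  assumes "group H" "h \<in> hom (free_group X) H" "k \<in> hom (free_group X) H"
    and "\<And>x. x \<in> X \<Longrightarrow> h (free_gen x) = k (free_gen x)" and "w \<in> carrier (free_group X)"
  shows "h w = k w"
  using assms hom_free_group_eq_eval_word[of H h X w] hom_free_group_eq_eval_word[of H k X w]
    eval_word_cong[of w X "\<lambda>x. h (free_gen x)" "\<lambda>x. k (free_gen x)" H]
  by (simp add: carrier_free_group_iff)

definition word_class :: "'a set \<Rightarrow> 'a word set \<Rightarrow> 'a word \<Rightarrow> 'a word set" where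
  "word_class X R w = normal_closure (free_group X) R #>\<^bsub>free_group X\<^esub> w"

lemma normal_closure_superset: "R \<subseteq> normal_closure G R"
  by (auto simp: normal_closure_def)

lemma normal_closure_least: "N \<lhd> G \<Longrightarrow> R \<subseteq> N \<Longrightarrow> normal_closure G R \<subseteq> N"
  by (auto simp: normal_closure_def)

lemma word_class_hom:
  assumes "R \<subseteq> carrier (free_group X)"
  shows "word_class X R \<in> hom (free_group X) (presented_group X R)"
proof -
  interpret normal "normal_closure (free_group X) R" "free_group X"
    by (intro normal_normal_closure group_free_group assms)
  show ?thesis
    using r_coset_hom_Mod unfolding word_class_def[abs_def] presented_group_def .
qed

lemma carrier_presented_group:
  "carrier (presented_group X R) = word_class X R ` carrier (free_group X)"
  by (auto simp: presented_group_def FactGroup_def RCOSETS_def word_class_def)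

lemma word_class_eq_one_iff:
  assumes "R \<subseteq> carrier (free_group X)" "w \<in> carrier (free_group X)"
  shows "word_class X R w = \<one>\<^bsub>presented_group X R\<^esub> \<longleftrightarrow> w \<in> normal_closure (free_group X) R"
proof -
  interpret group "free_group X" by (rule group_free_group)
  interpret normal "normal_closure (free_group X) R" "free_group X"
    by (intro normal_normal_closure group_free_group assms)
  show ?thesis
    using assms coset_join1[OF _ assms(2) subgroup_axioms] coset_join2[OF assms(2) subgroup_axioms] subset
    by (auto simp: word_class_def presented_group_def FactGroup_def)
qed

lemma word_class_relator:
  assumes "R \<subseteq> carrier (free_group X)" "r \<in> R"
  shows "word_class X R r = \<one>\<^bsub>presented_group X R\<^esub>"
  using assms normal_closure_superset[of R] by (subst word_class_eq_one_iff) auto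

text \<open>
  Von Dyck's theorem: the kernel of the evaluation is a normal subgroup, so it contains the normal
  closure of the relators as soon as it contains the relators themselves.
\<close>

lemma von_dyck:
  assumes "group H" and R: "R \<subseteq> carrier (free_group X)" and f: "f \<in> X \<rightarrow> carrier H"
    and rel: "\<And>r. r \<in> R \<Longrightarrow> eval_word H f r = \<one>\<^bsub>H\<^esub>"
  obtains h where "h \<in> hom (presented_group X R) H"
    and "\<And>w. w \<in> carrier (free_group X) \<Longrightarrow> h (word_class X R w) = eval_word H f w"
proof -
  interpret group_hom "free_group X" H "eval_word H f"
    using assms group.eval_word_hom by (auto simp: group_hom_def group_hom_axioms_def group_free_group)
  have "normal_closure (free_group X) R \<subseteq> kernel (free_group X) H (eval_word H f)"
    using R rel by (intro normal_closure_least normal_kernel) (auto simp: kernel_def)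
  then show ?thesis
    using FactGroup_universal_kernel[OF normal_normal_closure[OF group_free_group R]] that
    unfolding presented_group_def word_class_def by metis
qed

text \<open>
  A candidate group \<open>H\<close> is recognised as the presented group by a homomorphism \<open>\<psi>\<close> back
  that is inverse to the one of von Dyck on the generators, hence everywhere.  This
  avoids any computation of the normal closure of the relators.
\<close>

lemma presented_group_isoI:
  assumes "group H" and R: "R \<subseteq> carrier (free_group X)" and f: "f \<in> X \<rightarrow> carrier H"
    and rel: "\<And>r. r \<in> R \<Longrightarrow> eval_word H f r = \<one>\<^bsub>H\<^esub>"
    and surj: "carrier H \<subseteq> eval_word H f ` carrier (free_group X)"
    and psi: "\<psi> \<in> hom H (presented_group X R)"
      "\<And>x. x \<in> X \<Longrightarrow> \<psi> (f x) = word_class X R (free_gen x)"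
  shows "presented_group X R \<cong> H"
proof -
  interpret H: group H by fact
  obtain h where h: "h \<in> hom (presented_group X R) H"
    and h_class: "\<And>w. w \<in> carrier (free_group X) \<Longrightarrow> h (word_class X R w) = eval_word H f w"
    using von_dyck[OF assms(1) R f rel] by blast
  note Q = group_presented_group[OF R]
  have psi_eval: "\<psi> (eval_word H f w) = word_class X R w" if "w \<in> carrier (free_group X)" for w
  proof -
    have "\<psi> \<circ> eval_word H f \<in> hom (free_group X) (presented_group X R)"
      using H.eval_word_hom[OF f] psi(1) by (rule hom_compose)
    then have "(\<psi> \<circ> eval_word H f) w = word_class X R w"
      by (rule hom_free_group_eqI[OF Q _ word_class_hom[OF R]])
        (use that psi f H.eval_word_free_gen[of f] in \<open>simp_all add: Pi_iff\<close>)
    then show ?thesis by simp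
  qed
  have "inj_on h (carrier (presented_group X R))"
    by (rule inj_on_inverseI[where g = \<psi>]) (auto simp: carrier_presented_group h_class psi_eval)
  moreover have "h ` carrier (presented_group X R) = carrier H"
    using surj h_class H.eval_word_hom[OF f] by (force simp: carrier_presented_group image_image hom_def)
  ultimately show ?thesis
    using h by (intro is_isoI[of h]) (simp add: iso_def bij_betw_def)
qed

lemma infinite_presented_groupI:
  assumes "group H" "R \<subseteq> carrier (free_group X)" "f \<in> X \<rightarrow> carrier H"
    and "\<And>r. r \<in> R \<Longrightarrow> eval_word H f r = \<one>\<^bsub>H\<^esub>"
    and inf: "infinite (eval_word H f ` carrier (free_group X))"
  shows "infinite (carrier (presented_group X R))"
proof
  assume fin: "finite (carrier (presented_group X R))"
  obtain h where "\<And>w. w \<in> carrier (free_group X) \<Longrightarrow> h (word_class X R w) = eval_word H f w"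
    using von_dyck[OF assms(1-4)] by blast
  then have "eval_word H f ` carrier (free_group X) = h ` carrier (presented_group X R)"
    by (auto simp: carrier_presented_group image_iff)
  then show False
    using inf fin by simp
qed

lemma infinite_presented_groupI_powers:
  assumes H: "group H" and R: "R \<subseteq> carrier (free_group X)" and f: "f \<in> X \<rightarrow> carrier H"
    and rel: "\<And>r. r \<in> R \<Longrightarrow> eval_word H f r = \<one>\<^bsub>H\<^esub>"
    and w: "w \<in> carrier (free_group X)"
    and inj: "inj (\<lambda>n::nat. eval_word H f w [^]\<^bsub>H\<^esub> n)"
  shows "infinite (carrier (presented_group X R))"
proof (rule infinite_presented_groupI[OF H R f rel])
  interpret group_hom "free_group X" H "eval_word H f"
    using H f group.eval_word_hom by (auto simp: group_hom_def group_hom_axioms_def group_free_group)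
  have "range (\<lambda>n::nat. eval_word H f w [^]\<^bsub>H\<^esub> n) \<subseteq> eval_word H f ` carrier (free_group X)"
    using hom_nat_pow[OF w] G.nat_pow_closed[OF w] by (metis image_eqI image_subsetI)
  then show "infinite (eval_word H f ` carrier (free_group X))"
    using inj infinite_super range_inj_infinite by blast
qed auto


section \<open>Irredundant presentations of finite groups\<close>

text \<open>
  The multiplication table: the generators are indexed by \<open>f\<close> by the elements of the group, and
  the relators state every product of two elements.  Sending an element to the class of its
  generator is then a homomorphism, as the recognition criterion requires.
\<close>

lemma finite_group_finite_presentation:
  fixes G :: "('g, 'm) monoid_scheme"
  assumes "group G" "finite (carrier G)"
  shows "\<exists>(X :: nat set) R. finite_presentation X R G"
proof -
  interpret G: group G by fact
  obtain f and X :: "nat set" where X: "finite X" and f: "bij_betw f X (carrier G)"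
    using ex_bij_betw_nat_finite[OF assms(2)] by auto
  define \<phi> where "\<phi> = the_inv_into X f"
  have \<phi>: "\<phi> g \<in> X" "f (\<phi> g) = g" if "g \<in> carrier G" for g
    using that f by (auto simp: \<phi>_def bij_betw_def f_the_inv_into_f intro!: the_inv_into_into)
  have \<phi>_f: "\<phi> (f x) = x" if "x \<in> X" for x
    using that f by (auto simp: \<phi>_def bij_betw_def the_inv_into_f_f)
  have fX: "f \<in> X \<rightarrow> carrier G"
    using f by (auto simp: bij_betw_def)
  interpret F: group "free_group X" by (rule group_free_group)
  define rel where "rel = (\<lambda>(x, y). free_gen x \<otimes>\<^bsub>free_group X\<^esub> free_gen y
      \<otimes>\<^bsub>free_group X\<^esub> inv\<^bsub>free_group X\<^esub> (free_gen (\<phi> (f x \<otimes>\<^bsub>G\<^esub> f y))))"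
  define R where "R = rel ` (X \<times> X)"
  have gen: "free_gen x \<in> carrier (free_group X)" if "x \<in> X" for x
    using that by (rule free_gen_closed)
  have R: "R \<subseteq> carrier (free_group X)"
    using fX gen \<phi>(1) by (auto simp: R_def rel_def Pi_iff)
  note Q = group_presented_group[OF R]
  interpret ev: group_hom "free_group X" G "eval_word G f"
    using assms G.eval_word_hom[OF fX] by (simp add: group_hom_def group_hom_axioms_def F.group_axioms)
  interpret cl: group_hom "free_group X" "presented_group X R" "word_class X R"
    using word_class_hom[OF R] Q by (simp add: group_hom_def group_hom_axioms_def F.group_axioms)
  have ev_gen: "eval_word G f (free_gen x) = f x" if "x \<in> X" for x
    using that fX by (simp add: G.eval_word_free_gen Pi_iff)
  have "presented_group X R \<cong> G"
  proof (rule presented_group_isoI[OF assms(1) R fX, where \<psi> = "\<lambda>g. word_class X R (free_gen (\<phi> g))"])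
    fix r assume "r \<in> R"
    then show "eval_word G f r = \<one>\<^bsub>G\<^esub>"
      using gen \<phi> fX by (auto simp: R_def rel_def Pi_iff ev_gen)
  next
    show "carrier G \<subseteq> eval_word G f ` carrier (free_group X)"
      using ev_gen \<phi> gen by (metis image_eqI subsetI)
  next
    show "(\<lambda>g. word_class X R (free_gen (\<phi> g))) \<in> hom G (presented_group X R)"
    proof (rule homI)
      fix g h assume gh: "g \<in> carrier G" "h \<in> carrier G"
      let ?c = "\<lambda>g. word_class X R (free_gen (\<phi> g))"
      have "rel (\<phi> g, \<phi> h) \<in> R"
        using gh \<phi> by (auto simp: R_def)
      then have "word_class X R (rel (\<phi> g, \<phi> h)) = \<one>\<^bsub>presented_group X R\<^esub>"
        by (rule word_class_relator[OF R])
      then have "?c g \<otimes>\<^bsub>presented_group X R\<^esub> ?c h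
          \<otimes>\<^bsub>presented_group X R\<^esub> inv\<^bsub>presented_group X R\<^esub> ?c (g \<otimes>\<^bsub>G\<^esub> h) = \<one>\<^bsub>presented_group X R\<^esub>"
        using gh \<phi> gen by (simp add: rel_def)
      then show "?c (g \<otimes>\<^bsub>G\<^esub> h) = ?c g \<otimes>\<^bsub>presented_group X R\<^esub> ?c h"
        using gh \<phi> gen cl.H.inv_solve_right'[of "\<one>\<^bsub>presented_group X R\<^esub>"
            "?c g \<otimes>\<^bsub>presented_group X R\<^esub> ?c h" "?c (g \<otimes>\<^bsub>G\<^esub> h)"]
        by simp
    qed (use \<phi> gen in auto)
  next
    fix x assume "x \<in> X"
    then show "word_class X R (free_gen (\<phi> (f x))) = word_class X R (free_gen x)"
      by (simp add: \<phi>_f)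
  qed
  moreover have "finite R"
    using X by (simp add: R_def)
  ultimately show ?thesis
    using R X by (auto simp: finite_presentation_def is_presentation_def)
qed

lemma presented_group_remove_redundant:
  assumes R: "R \<subseteq> carrier (free_group X)"
    and r: "r \<in> normal_closure (free_group X) (R - {r})"
  shows "presented_group X (R - {r}) = presented_group X R"
proof -
  have "normal_closure (free_group X) (R - {r}) \<lhd> free_group X"
    using R by (intro normal_normal_closure group_free_group) auto
  then have "normal_closure (free_group X) R \<subseteq> normal_closure (free_group X) (R - {r})"
    using r normal_closure_superset[of "R - {r}" "free_group X"] by (intro normal_closure_least) auto
  moreover have "normal_closure (free_group X) (R - {r}) \<subseteq> normal_closure (free_group X) R"
    by (auto simp: normal_closure_def)
  ultimately show ?thesis
    by (simp add: presented_group_def)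
qed

lemma finite_group_irredundant_presentation:
  fixes G :: "('g, 'm) monoid_scheme"
  assumes "group G" "finite (carrier G)"
  shows "\<exists>(X :: nat set) R. finite_presentation X R G \<and>
    (\<forall>r\<in>R. r \<notin> normal_closure (free_group X) (R - {r}))"
proof -
  obtain X :: "nat set" and R\<^sub>0 where "finite_presentation X R\<^sub>0 G"
    using finite_group_finite_presentation[OF assms] by blast
  then obtain R where R: "finite_presentation X R G"
    and least: "\<And>S. finite_presentation X S G \<Longrightarrow> card R \<le> card S"
    using ex_has_least_nat[of "\<lambda>R. finite_presentation X R G" R\<^sub>0 card] by blast
  have "r \<notin> normal_closure (free_group X) (R - {r})" if "r \<in> R" for r
  proof
    assume "r \<in> normal_closure (free_group X) (R - {r})"
    then have "finite_presentation X (R - {r}) G"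
      using R presented_group_remove_redundant[of R X r]
      by (auto simp: finite_presentation_def is_presentation_def)
    then show False
      using least R that card_Diff1_less[of R r] by (fastforce simp: finite_presentation_def)
  qed
  then show ?thesis
    using R by blast
qed


section \<open>Two squared elements over a nontrivial element of a finite group\<close>

definition perm_group :: "('a \<Rightarrow> 'a) monoid" where
  "perm_group = \<lparr>carrier = {f. bij f}, mult = (\<circ>), one = id\<rparr>"

lemma perm_group_simps:
  "carrier perm_group = {f. bij f}" "f \<otimes>\<^bsub>perm_group\<^esub> g = f \<circ> g" "\<one>\<^bsub>perm_group\<^esub> = id"
  by (simp_all add: perm_group_def)

lemma group_perm_group: "group perm_group"
proof (rule groupI)
  fix f :: "'a \<Rightarrow> 'a" assume "f \<in> carrier perm_group"
  then show "\<exists>g\<in>carrier perm_group. g \<otimes>\<^bsub>perm_group\<^esub> f = \<one>\<^bsub>perm_group\<^esub>"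
    by (intro bexI[of _ "inv_into UNIV f"])
      (auto simp: perm_group_simps bij_imp_bij_inv bij_is_inj)
qed (auto simp: perm_group_simps bij_comp comp_assoc)

lemma pow_perm_group: "f [^]\<^bsub>perm_group\<^esub> (n::nat) = f ^^ n"
proof -
  interpret group "perm_group :: ('a \<Rightarrow> 'a) monoid" by (rule group_perm_group)
  show ?thesis
    by (induction n) (simp_all add: funpow_Suc_right perm_group_simps del: funpow.simps(2))
qed

text \<open>
  Let \<open>r\<close> have order \<open>m \<ge> 2\<close>.  Along the powers of \<open>r\<close> the function takes the values
  \<open>\<omega>, \<omega>^2, \<omega>^4, \<dots>\<close>; these match up after \<open>m\<close> steps when
  \<open>\<omega>^(2^m - 1) = 1\<close>, and \<open>2^m - 1 \<ge> 3\<close> leaves room for \<open>\<omega> \<noteq> 1\<close>.  Elsewhere the function is \<open>1\<close>.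
\<close>

lemma (in group) squaring_function:
  assumes fin: "finite (carrier G)" and r: "r \<in> carrier G" "r \<noteq> \<one>"
  shows "\<exists>\<zeta> :: 'a \<Rightarrow> complex. (\<forall>g. \<zeta> g \<noteq> 0) \<and> (\<forall>g\<in>carrier G. \<zeta> (r \<otimes> g) = \<zeta> g ^ 2)
    \<and> (\<forall>g. g \<notin> carrier G \<longrightarrow> \<zeta> g = 1) \<and> \<zeta> \<one> \<noteq> 1"
proof -
  define m where "m = ord r"
  have "m > 0" "m \<noteq> 1"
    using ord_ge_1[OF fin r(1)] ord_eq_1[OF r(1)] r(2) by (auto simp: m_def)
  then have "m \<ge> 2" by simp
  then have "(2::nat) ^ 2 \<le> 2 ^ m" by (intro power_increasing) auto
  then have K: "(2::nat) ^ m - 1 > 1" by simp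
  then have "card {z::complex. z ^ (2 ^ m - 1) = 1} = 2 ^ m - 1"
    by (intro card_roots_unity_eq) simp
  then have "card {z::complex. z ^ (2 ^ m - 1) = 1} > card {1::complex}"
    using K by simp
  then have "\<not> {z::complex. z ^ (2 ^ m - 1) = 1} \<subseteq> {1}"
    using card_mono[of "{1::complex}"] by (metis finite.emptyI finite.insertI not_less)
  then obtain \<omega> :: complex where \<omega>: "\<omega> ^ (2 ^ m - 1) = 1" "\<omega> \<noteq> 1"
    by blast
  have "\<omega> \<noteq> 0"
  proof
    assume "\<omega> = 0"
    then have "\<omega> ^ (2 ^ m - 1) = 0"
      using K by (intro power_eq_0_iff[THEN iffD2]) auto
    then show False
      unfolding \<omega>(1) by simp
  qed
  have \<omega>_pow: "\<omega> ^ 2 ^ m = \<omega>"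
    using \<omega>(1) power_minus_mult[of "2 ^ m" \<omega>] by simp
  define \<zeta> where "\<zeta> g = (\<Prod>i<m. if r [^] i = g then \<omega> ^ 2 ^ i else 1)" for g
  have "\<zeta> (r \<otimes> g) = \<zeta> g ^ 2" if g: "g \<in> carrier G" for g
  proof -
    define P where "P i = (if r [^] i = r \<otimes> g then \<omega> ^ 2 ^ i else 1)" for i
    have shift: "P (Suc i) = (if r [^] i = g then \<omega> ^ 2 ^ i else 1) ^ 2" for i
    proof -
      have "r [^] Suc i = r \<otimes> g \<longleftrightarrow> r [^] i = g"
        unfolding nat_pow_Suc2[OF r(1)] using r(1) g by simp
      then show ?thesis
        by (simp add: P_def mult.commute flip: power_mult)
    qed
    (* The product for r g runs over 0, ..., m - 1, the shifted one over 1, ..., m. *)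
    have "P m = P 0"
      using r(1) \<omega>_pow by (simp add: P_def m_def)
    have "P 0 * (\<Prod>i<m. P (Suc i)) = (\<Prod>i<m. P i) * P m"
      using prod.lessThan_Suc_shift[of P m] by simp
    moreover have "P 0 \<noteq> 0"
      using \<open>\<omega> \<noteq> 0\<close> by (simp add: P_def)
    ultimately have "(\<Prod>i<m. P i) = (\<Prod>i<m. P (Suc i))"
      using \<open>P m = P 0\<close> by simp
    then show ?thesis
      by (simp add: shift \<zeta>_def prod_power_distrib) (simp add: P_def)
  qed
  moreover have "\<zeta> \<one> = \<omega>"
  proof -
    have "r [^] i = \<one> \<longleftrightarrow> i = 0" if "i < m" for i
      using that pow_eq_id[OF r(1), of i] by (auto simp: m_def dest: nat_dvd_not_less)
    then have "\<zeta> \<one> = (\<Prod>i<m. if i = 0 then \<omega> else 1)"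
      unfolding \<zeta>_def by (intro prod.cong) auto
    then show ?thesis
      using \<open>m > 0\<close> by (simp add: prod.delta)
  qed
  moreover have "\<zeta> g \<noteq> 0" for g
    using \<open>\<omega> \<noteq> 0\<close> by (auto simp: \<zeta>_def)
  moreover have "\<zeta> g = 1" if "g \<notin> carrier G" for g
    using that r(1) by (auto simp: \<zeta>_def intro!: prod.neutral)
  ultimately show ?thesis
    using \<omega>(2) by metis
qed

text \<open>
  The group acts on copies of the complex plane indexed by its elements, by left translation of
  the index.  Let \<open>b\<close> rotate the plane of index \<open>g\<close> about \<open>0\<close> by the factor \<open>\<zeta> g\<close>; the
  equation \<open>\<zeta> (r g) = (\<zeta> g)^2\<close> says that conjugation by \<open>r\<close> squares \<open>b\<close>.  With
  \<open>t\<close> the translation by \<open>1\<close> in every plane, which commutes with the group, conjugation by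
  \<open>r\<close> also squares \<open>c = t b\<inverse> t\<inverse>\<close>.  The product of the rotation \<open>b\<close> about \<open>0\<close> with the
  opposite rotation \<open>c\<close> about \<open>1\<close> is a translation, and a nontrivial one in the plane of index \<open>\<one>\<close>.
\<close>

lemma (in group) squared_pair:
  assumes fin: "finite (carrier G)" and r: "r \<in> carrier G" "r \<noteq> \<one>"
  obtains H :: "('a \<times> complex \<Rightarrow> 'a \<times> complex) monoid" and \<rho> b c
  where "group H" "\<rho> \<in> hom G H" "b \<in> carrier H" "c \<in> carrier H"
    and "b \<otimes>\<^bsub>H\<^esub> \<rho> r = \<rho> r \<otimes>\<^bsub>H\<^esub> (b \<otimes>\<^bsub>H\<^esub> b)"
    and "c \<otimes>\<^bsub>H\<^esub> \<rho> r = \<rho> r \<otimes>\<^bsub>H\<^esub> (c \<otimes>\<^bsub>H\<^esub> c)"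
    and "inj (\<lambda>n::nat. (c \<otimes>\<^bsub>H\<^esub> b) [^]\<^bsub>H\<^esub> n)"
proof -
  obtain \<zeta> :: "'a \<Rightarrow> complex" where \<zeta>: "\<And>g. \<zeta> g \<noteq> 0"
    "\<And>g. g \<in> carrier G \<Longrightarrow> \<zeta> (r \<otimes> g) = \<zeta> g ^ 2" "\<And>g. g \<notin> carrier G \<Longrightarrow> \<zeta> g = 1" "\<zeta> \<one> \<noteq> 1"
    using squaring_function[OF assms] by blast
  (* Planes with an index outside the group are fixed pointwise, to have permutations of the type. *)
  define \<rho> where "\<rho> h = (\<lambda>(g, z::complex). (if g \<in> carrier G then h \<otimes> g else g, z))" for h
  define b where "b = (\<lambda>(g, z). (g, \<zeta> g * z))"
  define c where "c = (\<lambda>(g, z). (g, (z - 1) / \<zeta> g + 1))"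
  have \<rho>_mult: "\<rho> (h \<otimes> k) = \<rho> h \<circ> \<rho> k" if "h \<in> carrier G" "k \<in> carrier G" for h k
    using that by (auto simp: \<rho>_def m_assoc fun_eq_iff)
  have \<rho>_one: "\<rho> \<one> = id"
    by (auto simp: \<rho>_def fun_eq_iff)
  have "\<rho> h \<in> carrier perm_group" if "h \<in> carrier G" for h
    using that \<rho>_mult[of h "inv h"] \<rho>_mult[of "inv h" h] \<rho>_one
    by (auto simp: perm_group_simps intro!: o_bij[of "\<rho> (inv h)"])
  then have \<rho>: "\<rho> \<in> hom G perm_group"
    using \<rho>_mult by (auto intro!: homI simp: perm_group_simps)
  have b: "b \<in> carrier perm_group"
    using \<zeta>(1) unfolding perm_group_simps
    by (auto intro!: o_bij[of "\<lambda>(g, z). (g, z / \<zeta> g)"] simp: b_def fun_eq_iff)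
  have c: "c \<in> carrier perm_group"
    using \<zeta>(1) unfolding perm_group_simps
    by (auto intro!: o_bij[of "\<lambda>(g, z). (g, \<zeta> g * (z - 1) + 1)"] simp: c_def fun_eq_iff)
  have br: "b \<otimes>\<^bsub>perm_group\<^esub> \<rho> r = \<rho> r \<otimes>\<^bsub>perm_group\<^esub> (b \<otimes>\<^bsub>perm_group\<^esub> b)"
    using \<zeta> by (auto simp: perm_group_simps b_def \<rho>_def fun_eq_iff power2_eq_square)
  have cr: "c \<otimes>\<^bsub>perm_group\<^esub> \<rho> r = \<rho> r \<otimes>\<^bsub>perm_group\<^esub> (c \<otimes>\<^bsub>perm_group\<^esub> c)"
    using \<zeta> by (auto simp: perm_group_simps c_def \<rho>_def fun_eq_iff power2_eq_square)
  have iter: "((c \<circ> b) ^^ n) (\<one>, 0) = (\<one>, of_nat n * (1 - 1 / \<zeta> \<one>))" for n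
    using \<zeta>(1)[of \<one>] by (induction n) (auto simp: b_def c_def field_simps)
  have "inj (\<lambda>n::nat. (c \<circ> b) ^^ n)"
  proof (rule injI)
    fix i j :: nat assume "(c \<circ> b) ^^ i = (c \<circ> b) ^^ j"
    then have "of_nat i * (1 - 1 / \<zeta> \<one>) = of_nat j * (1 - 1 / \<zeta> \<one>)"
      using iter by (metis prod.inject)
    then show "i = j"
      using \<zeta>(4) by auto
  qed
  then have "inj (\<lambda>n::nat. (c \<otimes>\<^bsub>perm_group\<^esub> b) [^]\<^bsub>perm_group\<^esub> n)"
    unfolding pow_perm_group by (simp add: perm_group_simps)
  then show thesis
    using that[OF group_perm_group \<rho> b c br cr] by blast
qed


section \<open>Padding a presentation\<close>

definition squaring_relator :: "'a set \<Rightarrow> 'a word \<Rightarrow> 'a \<Rightarrow> 'a word" where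
  "squaring_relator Y s y = inv\<^bsub>free_group Y\<^esub> s \<otimes>\<^bsub>free_group Y\<^esub> free_gen y \<otimes>\<^bsub>free_group Y\<^esub> s
     \<otimes>\<^bsub>free_group Y\<^esub> inv\<^bsub>free_group Y\<^esub> (free_gen y \<otimes>\<^bsub>free_group Y\<^esub> free_gen y)"

lemma squaring_relator_closed:
  assumes "s \<in> carrier (free_group Y)" "y \<in> Y"
  shows "squaring_relator Y s y \<in> carrier (free_group Y)"
proof -
  interpret group "free_group Y" by (rule group_free_group)
  show ?thesis
    using assms by (simp add: squaring_relator_def free_gen_closed)
qed

lemma hom_squaring_relator_eq_one_iff:
  assumes "group H" "h \<in> hom (free_group Y) H" and s: "s \<in> carrier (free_group Y)" and y: "y \<in> Y"
  shows "h (squaring_relator Y s y) = \<one>\<^bsub>H\<^esub> \<longleftrightarrow>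
    h (free_gen y) \<otimes>\<^bsub>H\<^esub> h s = h s \<otimes>\<^bsub>H\<^esub> (h (free_gen y) \<otimes>\<^bsub>H\<^esub> h (free_gen y))"
proof -
  interpret group_hom "free_group Y" H h
    using assms by (simp add: group_hom_def group_hom_axioms_def group_free_group)
  note y' = free_gen_closed[OF y]
  let ?b = "h (free_gen y)"
  have cl: "?b \<in> carrier H" "h s \<in> carrier H" using y' s by auto
  have "h (squaring_relator Y s y)
      = inv\<^bsub>H\<^esub> h s \<otimes>\<^bsub>H\<^esub> ?b \<otimes>\<^bsub>H\<^esub> h s \<otimes>\<^bsub>H\<^esub> inv\<^bsub>H\<^esub> (?b \<otimes>\<^bsub>H\<^esub> ?b)"
    using s y' by (simp add: squaring_relator_def)
  also have "\<dots> = \<one>\<^bsub>H\<^esub> \<longleftrightarrow> inv\<^bsub>H\<^esub> h s \<otimes>\<^bsub>H\<^esub> ?b \<otimes>\<^bsub>H\<^esub> h s = ?b \<otimes>\<^bsub>H\<^esub> ?b"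
    using cl H.inv_solve_right'[of "\<one>\<^bsub>H\<^esub>" _ "?b \<otimes>\<^bsub>H\<^esub> ?b"] by auto
  also have "\<dots> \<longleftrightarrow> ?b \<otimes>\<^bsub>H\<^esub> h s = h s \<otimes>\<^bsub>H\<^esub> (?b \<otimes>\<^bsub>H\<^esub> ?b)"
    using cl H.inv_solve_left' [of "?b \<otimes>\<^bsub>H\<^esub> ?b" "h s" "?b \<otimes>\<^bsub>H\<^esub> h s"] by (simp add: H.m_assoc)
  finally show ?thesis .
qed

text \<open>
  Each relator receives two new generators, told apart by a Boolean.  One would not suffice: if
  \<open>r\<close> generates \<open>F\<close>, adjoining a single \<open>b\<close> with \<open>r\<inverse> b r = b^2\<close> to a finite \<open>F\<close> only
  gives a finite semidirect product.
\<close>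

locale padding =
  fixes X :: "'a set" and R :: "'a word set" and \<beta> :: "'a word \<times> bool \<Rightarrow> 'a"
  assumes R: "R \<subseteq> carrier (free_group X)"
    and inj_\<beta>: "inj_on \<beta> (R \<times> UNIV)"
    and \<beta>_new: "s \<in> R \<Longrightarrow> \<beta> (s, i) \<notin> X"
begin

definition padded_gens :: "'a set" where
  "padded_gens = X \<union> \<beta> ` (R \<times> UNIV)"

definition padded_relators :: "'a word set" where
  "padded_relators = R \<union> (\<lambda>(s, i). squaring_relator padded_gens s (\<beta> (s, i))) ` (R \<times> UNIV)"

lemma \<beta>_eq_iff: "s \<in> R \<Longrightarrow> t \<in> R \<Longrightarrow> \<beta> (s, i) = \<beta> (t, j) \<longleftrightarrow> s = t \<and> i = j"
  using inj_\<beta> by (auto simp: inj_on_def)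

lemma \<beta>_padded: "s \<in> R \<Longrightarrow> \<beta> (s, i) \<in> padded_gens"
  by (auto simp: padded_gens_def)

lemma free_gen_padded: "s \<in> R \<Longrightarrow> free_gen (\<beta> (s, i)) \<in> carrier (free_group padded_gens)"
  using \<beta>_padded by (rule free_gen_closed)

lemma free_group_padded: "w \<in> carrier (free_group X) \<Longrightarrow> w \<in> carrier (free_group padded_gens)"
  by (auto simp: carrier_free_group_iff padded_gens_def)

lemma padded_relators_closed: "padded_relators \<subseteq> carrier (free_group padded_gens)"
proof -
  have "squaring_relator padded_gens s (\<beta> (s, i)) \<in> carrier (free_group padded_gens)"
    if "s \<in> R" for s i
    using that R free_group_padded \<beta>_padded by (intro squaring_relator_closed) auto
  then show ?thesis
    using R free_group_padded by (auto simp: padded_relators_def)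
qed

definition assign :: "('a \<Rightarrow> 'h) \<Rightarrow> ('a \<Rightarrow> 'h) \<Rightarrow> 'a \<Rightarrow> 'h" where
  "assign f k x = (if x \<in> X then f x else k x)"

lemma eval_word_assign:
  "w \<in> carrier (free_group X) \<Longrightarrow> eval_word H (assign f k) w = eval_word H f w"
  using eval_word_cong[of w X "assign f k" f H] by (simp add: carrier_free_group_iff assign_def)

lemma assign_closed:
  assumes "f \<in> X \<rightarrow> carrier H" "\<And>s i. s \<in> R \<Longrightarrow> k (\<beta> (s, i)) \<in> carrier H"
  shows "assign f k \<in> padded_gens \<rightarrow> carrier H"
  using assms by (auto simp: padded_gens_def assign_def)

lemma eval_squaring_relator_assign:
  assumes "group H" and ext: "assign f k \<in> padded_gens \<rightarrow> carrier H" and s: "s \<in> R"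
  shows "eval_word H (assign f k) (squaring_relator padded_gens s (\<beta> (s, i))) = \<one>\<^bsub>H\<^esub> \<longleftrightarrow>
    k (\<beta> (s, i)) \<otimes>\<^bsub>H\<^esub> eval_word H f s = eval_word H f s \<otimes>\<^bsub>H\<^esub> (k (\<beta> (s, i)) \<otimes>\<^bsub>H\<^esub> k (\<beta> (s, i)))"
proof -
  interpret group H by fact
  have "eval_word H (assign f k) (free_gen (\<beta> (s, i))) = k (\<beta> (s, i))"
    using funcset_mem[OF ext \<beta>_padded[OF s]] \<beta>_new[OF s]
      eval_word_free_gen[of "assign f k" "\<beta> (s, i)"] by (simp add: assign_def)
  moreover have "eval_word H (assign f k) s = eval_word H f s"
    using R s eval_word_assign by blast
  ultimately show ?thesis
    using hom_squaring_relator_eq_one_iff[OF assms(1) eval_word_hom[OF ext] _ \<beta>_padded[OF s]]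
      R s free_group_padded by auto
qed

text \<open>
  Once \<open>s\<close> is trivial, the relator of a new generator \<open>y\<close> reads \<open>y = y^2\<close> and kills
  \<open>y\<close>.  So the padded presentation still presents the same group.
\<close>

lemma presented_group_padded: "presented_group padded_gens padded_relators \<cong> presented_group X R"
proof -
  let ?P = "presented_group X R" and ?Q = "presented_group padded_gens padded_relators"
  let ?cl = "word_class padded_gens padded_relators"
  note R' = padded_relators_closed
  interpret P: group ?P by (rule group_presented_group[OF R])
  interpret Q: group ?Q by (rule group_presented_group[OF R'])
  interpret cl: group_hom "free_group padded_gens" ?Q ?cl
    using word_class_hom[OF R'] Q.group_axioms by (simp add: group_hom_def group_hom_axioms_def group_free_group)
  define f where "f = assign (\<lambda>x. word_class X R (free_gen x)) (\<lambda>_. \<one>\<^bsub>?P\<^esub>)"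
  have f: "f \<in> padded_gens \<rightarrow> carrier ?P"
    unfolding f_def
    by (rule assign_closed) (use P.one_closed in \<open>auto simp: carrier_presented_group free_gen_closed\<close>)
  have eval_f: "eval_word ?P f w = word_class X R w" if "w \<in> carrier (free_group X)" for w
    using that eval_word_assign hom_free_group_eq_eval_word[OF P.group_axioms word_class_hom[OF R]]
    by (simp add: f_def)
  have R_one: "word_class X R s = \<one>\<^bsub>?P\<^esub>" if "s \<in> R" for s
    using word_class_relator[OF R that] .
  have cl_rel: "?cl s = \<one>\<^bsub>?Q\<^esub>" if "s \<in> padded_relators" for s
    using word_class_relator[OF R' that] .
  have cl_new: "?cl (free_gen (\<beta> (s, i))) = \<one>\<^bsub>?Q\<^esub>" if s: "s \<in> R" for s i
  proof -
    have "?cl (squaring_relator padded_gens s (\<beta> (s, i))) = \<one>\<^bsub>?Q\<^esub>" "?cl s = \<one>\<^bsub>?Q\<^esub>"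
      using cl_rel s by (auto simp: padded_relators_def)
    moreover have gen: "?cl (free_gen (\<beta> (s, i))) \<in> carrier ?Q"
      using free_gen_padded[OF s] by (rule cl.hom_closed)
    ultimately have "?cl (free_gen (\<beta> (s, i)))
        = ?cl (free_gen (\<beta> (s, i))) \<otimes>\<^bsub>?Q\<^esub> ?cl (free_gen (\<beta> (s, i)))"
      using hom_squaring_relator_eq_one_iff[OF Q.group_axioms cl.homh _ \<beta>_padded[OF s], of s i]
        R s free_group_padded by auto
    then show ?thesis
      using gen Q.l_cancel_one' by auto
  qed
  (* The homomorphism back is the one given by the inclusion of the old generators. *)
  have incl: "(\<lambda>x. ?cl (free_gen x)) \<in> X \<rightarrow> carrier ?Q"
    by (intro Pi_I cl.hom_closed free_group_padded free_gen_closed)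
  have cl_hom: "?cl \<in> hom (free_group X) ?Q"
    using cl.homh free_group_padded by (auto simp: hom_def free_group_def Pi_iff)
  have cl_eval: "eval_word ?Q (\<lambda>x. ?cl (free_gen x)) w = ?cl w" if "w \<in> carrier (free_group X)" for w
    using that hom_free_group_eq_eval_word[OF Q.group_axioms cl_hom] by simp
  have "eval_word ?Q (\<lambda>x. ?cl (free_gen x)) s = \<one>\<^bsub>?Q\<^esub>" if "s \<in> R" for s
    using that R cl_eval cl_rel by (auto simp: padded_relators_def)
  then obtain \<psi> where \<psi>: "\<psi> \<in> hom ?P ?Q"
    and \<psi>_class: "\<And>w. w \<in> carrier (free_group X) \<Longrightarrow>
      \<psi> (word_class X R w) = eval_word ?Q (\<lambda>x. ?cl (free_gen x)) w"
    using von_dyck[OF Q.group_axioms R incl] by blast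
  show ?thesis
  proof (rule presented_group_isoI[OF P.group_axioms R' f _ _ \<psi>])
    fix r assume "r \<in> padded_relators"
    then consider "r \<in> R" | s i where "s \<in> R" "r = squaring_relator padded_gens s (\<beta> (s, i))"
      by (auto simp: padded_relators_def)
    then show "eval_word ?P f r = \<one>\<^bsub>?P\<^esub>"
    proof cases
      case 1
      then show ?thesis using R eval_f R_one by auto
    next
      case (2 s i)
      have "eval_word ?P (\<lambda>x. word_class X R (free_gen x)) s = \<one>\<^bsub>?P\<^esub>"
        using 2 R eval_f R_one eval_word_assign by (metis f_def subsetD)
      then show ?thesis
        using 2 eval_squaring_relator_assign[OF P.group_axioms f[unfolded f_def]] by (simp add: f_def)
    qed
  next
    show "carrier ?P \<subseteq> eval_word ?P f ` carrier (free_group padded_gens)"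
      using eval_f free_group_padded by (force simp: carrier_presented_group image_iff)
  next
    fix x assume "x \<in> padded_gens"
    then consider "x \<in> X" | s i where "s \<in> R" "x = \<beta> (s, i)"
      by (auto simp: padded_gens_def)
    then show "\<psi> (f x) = ?cl (free_gen x)"
    proof cases
      case 1
      then show ?thesis
        using \<psi>_class cl_eval free_gen_closed[of x X] by (simp add: f_def assign_def)
    next
      case (2 s i)
      then show ?thesis
        using \<beta>_new cl_new hom_one[OF \<psi> P.group_axioms Q.group_axioms] by (simp add: f_def assign_def)
    qed
  qed
qed

text \<open>
  Without its own relator a new generator has infinite order: it maps to \<open>1\<close> in the integers when
  all the other generators map to \<open>0\<close>.
\<close>

lemma infinite_remove_squaring_relator:
  assumes s: "s \<in> R"
  shows "infinite (carrier (presented_group padded_gens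
    (padded_relators - {squaring_relator padded_gens s (\<beta> (s, i))})))"
proof -
  let ?Z = "integer_group"
  interpret Z: group ?Z by simp
  define k where "k = (\<lambda>y. if y = \<beta> (s, i) then 1 else 0 :: int)"
  have ext: "assign (\<lambda>_. 0) k \<in> padded_gens \<rightarrow> carrier ?Z"
    by simp
  have zero: "eval_word ?Z (\<lambda>_. 0) w = 0" for w :: "'a word"
    using Z.inv_one by (induction w) (auto simp: eval_word_def)
  have old: "eval_word ?Z (assign (\<lambda>_. 0) k) t = 0" if "t \<in> R" for t
    using that R eval_word_assign zero by (metis subsetD)
  show ?thesis
  proof (rule infinite_presented_groupI_powers[OF Z.group_axioms _ ext])
    show "free_gen (\<beta> (s, i)) \<in> carrier (free_group padded_gens)"
      by (rule free_gen_padded[OF s])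
    have "eval_word ?Z (assign (\<lambda>_. 0) k) (free_gen (\<beta> (s, i))) = 1"
      using s \<beta>_new by (simp add: Z.eval_word_free_gen assign_def k_def)
    moreover have "(1::int) [^]\<^bsub>?Z\<^esub> n = int n" for n :: nat
      by (induction n) simp_all
    ultimately show "inj (\<lambda>n::nat. eval_word ?Z (assign (\<lambda>_. 0) k) (free_gen (\<beta> (s, i))) [^]\<^bsub>?Z\<^esub> n)"
      by (simp add: inj_on_def)
  next
    fix r assume r: "r \<in> padded_relators - {squaring_relator padded_gens s (\<beta> (s, i))}"
    then consider "r \<in> R" | t j where "t \<in> R" "r = squaring_relator padded_gens t (\<beta> (t, j))"
      by (auto simp: padded_relators_def)
    then show "eval_word ?Z (assign (\<lambda>_. 0) k) r = \<one>\<^bsub>?Z\<^esub>"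
    proof cases
      case 1
      then show ?thesis using old by simp
    next
      case (2 t j)
      then have "(t, j) \<noteq> (s, i)"
        using r by blast
      then have "k (\<beta> (t, j)) = 0"
        using 2(1) s \<beta>_eq_iff by (auto simp: k_def)
      then show ?thesis
        using 2 eval_squaring_relator_assign[OF Z.group_axioms ext] zero by simp
    qed
  qed (use padded_relators_closed in auto)
qed

text \<open>
  Let \<open>F\<close> be the group of the original presentation without \<open>r\<close>.  If it is infinite, killing all
  new generators maps onto an infinite group.  If it is finite, \<open>r\<close> is a nontrivial element of it
  because \<open>r\<close> is not redundant, and the two new generators of \<open>r\<close> can be sent to the
  squared pair over \<open>r\<close>, with the other new generators killed.
\<close>

lemma infinite_remove_original_relator:
  assumes r: "r \<in> R" and irred: "r \<notin> normal_closure (free_group X) (R - {r})"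
  shows "infinite (carrier (presented_group padded_gens (padded_relators - {r})))"
proof -
  let ?F = "presented_group X (R - {r})" and ?e = "word_class X (R - {r})"
  have R0: "R - {r} \<subseteq> carrier (free_group X)" using R by auto
  have R': "padded_relators - {r} \<subseteq> carrier (free_group padded_gens)"
    using padded_relators_closed by auto
  interpret F: group ?F by (rule group_presented_group[OF R0])
  have e_closed: "?e w \<in> carrier ?F" if "w \<in> carrier (free_group X)" for w
    using that by (auto simp: carrier_presented_group)
  have e_rel: "?e s = \<one>\<^bsub>?F\<^esub>" if "s \<in> R" "s \<noteq> r" for s
    using word_class_relator[OF R0] that by simp
  have cases_rel: thesis if "t \<in> padded_relators - {r}" "t \<in> R \<Longrightarrow> t \<noteq> r \<Longrightarrow> thesis"
    "\<And>s i. s \<in> R \<Longrightarrow> t = squaring_relator padded_gens s (\<beta> (s, i)) \<Longrightarrow> thesis" for t thesis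
    using that by (auto simp: padded_relators_def)
  show ?thesis
  proof (cases "finite (carrier ?F)")
    case False
    let ?f = "\<lambda>x. ?e (free_gen x)"
    let ?g = "assign ?f (\<lambda>_. \<one>\<^bsub>?F\<^esub>)"
    have ev: "eval_word ?F ?f w = ?e w" if "w \<in> carrier (free_group X)" for w
      using that hom_free_group_eq_eval_word[OF F.group_axioms word_class_hom[OF R0]] by simp
    have ext: "?g \<in> padded_gens \<rightarrow> carrier ?F"
      by (rule assign_closed) (auto simp: e_closed free_gen_closed)
    show ?thesis
    proof (rule infinite_presented_groupI[OF F.group_axioms R' ext])
      fix t assume "t \<in> padded_relators - {r}"
      then show "eval_word ?F ?g t = \<one>\<^bsub>?F\<^esub>"
      proof (rule cases_rel)
        assume "t \<in> R" "t \<noteq> r"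
        then show ?thesis
          using R eval_word_assign[of t ?F ?f] ev e_rel by auto
      next
        fix s i assume "s \<in> R" "t = squaring_relator padded_gens s (\<beta> (s, i))"
        then show ?thesis
          using R eval_squaring_relator_assign[OF F.group_axioms ext] ev e_closed by auto
      qed
    next
      have "carrier ?F \<subseteq> eval_word ?F ?g ` carrier (free_group padded_gens)"
        using ev eval_word_assign[of _ ?F ?f] free_group_padded
        by (auto simp: carrier_presented_group image_iff) metis
      then show "infinite (eval_word ?F ?g ` carrier (free_group padded_gens))"
        using False finite_subset by blast
    qed
  next
    case True
    have "?e r \<in> carrier ?F" "?e r \<noteq> \<one>\<^bsub>?F\<^esub>"
      using r R e_closed irred word_class_eq_one_iff[OF R0] by auto
    then obtain H :: "('a word set \<times> complex \<Rightarrow> 'a word set \<times> complex) monoid" and \<rho> b c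
      where H: "group H" and \<rho>: "\<rho> \<in> hom ?F H" and bc: "b \<in> carrier H" "c \<in> carrier H"
        and b: "b \<otimes>\<^bsub>H\<^esub> \<rho> (?e r) = \<rho> (?e r) \<otimes>\<^bsub>H\<^esub> (b \<otimes>\<^bsub>H\<^esub> b)"
        and c: "c \<otimes>\<^bsub>H\<^esub> \<rho> (?e r) = \<rho> (?e r) \<otimes>\<^bsub>H\<^esub> (c \<otimes>\<^bsub>H\<^esub> c)"
        and inj: "inj (\<lambda>n::nat. (c \<otimes>\<^bsub>H\<^esub> b) [^]\<^bsub>H\<^esub> n)"
      using F.squared_pair[OF True] by metis
    interpret H: group H by fact
    define f where "f = (\<lambda>x. \<rho> (?e (free_gen x)))"
    define k where "k = (\<lambda>y. if y = \<beta> (r, True) then b else if y = \<beta> (r, False) then c else \<one>\<^bsub>H\<^esub>)"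
    have \<rho>e: "(\<lambda>w. \<rho> (?e w)) \<in> hom (free_group X) H"
      using hom_compose[OF word_class_hom[OF R0] \<rho>] by (simp add: comp_def)
    have ev: "eval_word H f w = \<rho> (?e w)" if "w \<in> carrier (free_group X)" for w
      using that hom_free_group_eq_eval_word[OF H \<rho>e] by (simp add: f_def)
    have \<rho>e_closed: "\<rho> (?e w) \<in> carrier H" if "w \<in> carrier (free_group X)" for w
      using that \<rho>e by (auto simp: hom_def)
    have ext: "assign f k \<in> padded_gens \<rightarrow> carrier H"
      using bc by (intro assign_closed) (auto simp: f_def k_def \<rho>e_closed free_gen_closed)
    have k: "k (\<beta> (r, True)) = b" "k (\<beta> (r, False)) = c"
      using r \<beta>_eq_iff by (auto simp: k_def)
    have k_other: "k (\<beta> (s, i)) = \<one>\<^bsub>H\<^esub>" if "s \<in> R" "s \<noteq> r" for s i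
      using that r \<beta>_eq_iff by (auto simp: k_def)
    let ?w = "free_gen (\<beta> (r, False)) \<otimes>\<^bsub>free_group padded_gens\<^esub> free_gen (\<beta> (r, True))"
    interpret E: group_hom "free_group padded_gens" H "eval_word H (assign f k)"
      using H H.eval_word_hom[OF ext] by (simp add: group_hom_def group_hom_axioms_def group_free_group)
    have gen: "free_gen (\<beta> (r, i)) \<in> carrier (free_group padded_gens)" for i
      by (rule free_gen_padded[OF r])
    show ?thesis
    proof (rule infinite_presented_groupI_powers[OF H R' ext])
      fix t assume "t \<in> padded_relators - {r}"
      then show "eval_word H (assign f k) t = \<one>\<^bsub>H\<^esub>"
      proof (rule cases_rel)
        assume "t \<in> R" "t \<noteq> r"
        then show ?thesis
          using R eval_word_assign[of t H f] ev e_rel hom_one[OF \<rho> F.group_axioms H] by auto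
      next
        fix s i assume s: "s \<in> R" and t: "t = squaring_relator padded_gens s (\<beta> (s, i))"
        have "k (\<beta> (s, i)) \<otimes>\<^bsub>H\<^esub> \<rho> (?e s) = \<rho> (?e s) \<otimes>\<^bsub>H\<^esub> (k (\<beta> (s, i)) \<otimes>\<^bsub>H\<^esub> k (\<beta> (s, i)))"
        proof (cases "s = r")
          case True
          then show ?thesis using b c k by (cases i) auto
        next
          case False
          then show ?thesis using s R k_other \<rho>e_closed by auto
        qed
        then show ?thesis
          using s t R ev eval_squaring_relator_assign[OF H ext] by auto
      qed
    next
      show "?w \<in> carrier (free_group padded_gens)"
        using gen E.G.m_closed by blast
      have "eval_word H (assign f k) ?w = c \<otimes>\<^bsub>H\<^esub> b"
        using gen r \<beta>_new k bc by (simp add: H.eval_word_free_gen assign_def)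
      then show "inj (\<lambda>n::nat. eval_word H (assign f k) ?w [^]\<^bsub>H\<^esub> n)"
        using inj by simp
    qed
  qed
qed

end


section \<open>Just finite presentations\<close>

theorem theorem1:
  fixes G :: "('g, 'm) monoid_scheme"
  assumes "group G" and "finite (carrier G)"
  shows "\<exists>(X :: nat set) R. finite_presentation X R G \<and> just_finite_presentation X R G"
proof -
  obtain X :: "nat set" and R where pres: "finite_presentation X R G"
    and irred: "\<And>r. r \<in> R \<Longrightarrow> r \<notin> normal_closure (free_group X) (R - {r})"
    using finite_group_irredundant_presentation[OF assms] by blast
  have fin: "finite X" "finite R" and R: "R \<subseteq> carrier (free_group X)"
    and iso: "presented_group X R \<cong> G"
    using pres by (auto simp: finite_presentation_def is_presentation_def)
  have "infinite (- X)"
    using fin by (simp add: Compl_eq_Diff_UNIV)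
  then obtain B where B: "finite B" "card B = card (R \<times> (UNIV :: bool set))" "B \<subseteq> - X"
    using infinite_arbitrarily_large by blast
  then obtain \<beta> where \<beta>: "bij_betw \<beta> (R \<times> (UNIV :: bool set)) B"
    using fin finite_same_card_bij[of "R \<times> (UNIV :: bool set)" B] by auto
  interpret padding X R \<beta>
  proof
    show "\<beta> (s, i) \<notin> X" if "s \<in> R" for s i
      using that bij_betwE[OF \<beta>] B(3) by blast
  qed (use R \<beta> in \<open>simp_all add: bij_betw_def\<close>)
  have "presented_group padded_gens padded_relators \<cong> G"
    using presented_group_padded iso by (rule iso_trans)
  moreover have "finite padded_gens" "finite padded_relators"
    using fin by (auto simp: padded_gens_def padded_relators_def)
  moreover have "infinite (carrier (presented_group padded_gens (padded_relators - {r})))"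
    if "r \<in> padded_relators" for r
  proof (cases "r \<in> R")
    case True
    then show ?thesis using irred by (intro infinite_remove_original_relator)
  next
    case False
    then show ?thesis
      using that infinite_remove_squaring_relator by (auto simp: padded_relators_def)
  qed
  ultimately show ?thesis
    using assms(2) padded_relators_closed
    unfolding finite_presentation_def just_finite_presentation_def is_presentation_def by blast
qed

end
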